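(* Consider the dual problem $\inf_{r\ge0,\ \theta\in[0,\pi],\ \phi\in[0,2\pi)}F(r,\theta,\phi)$ subject to $r\sin\theta\cos\phi\ge0$, where $$F(r,\theta,\phi)=r\sin\theta\cos\phi\,\delta+r\cos\theta\,\mu+r\sin\theta\sin\phi\,(\sigma^2+\mu^2)+\frac1n\sum_{k=1}^n\sup_{x\in\mathbb{R}}\big[(x-\tau)_+-r\sin\theta\cos\phi\,(x-x_k)^2-r\cos\theta\,x-r\sin\theta\sin\phi\,x^2\big].$$ Its solution can be computed (approximately) using a two-dimensional grid search in angles $(\theta,\phi)$ subject to the constraint $\sin\theta(\cos\phi+\sin\phi)>0$ and evaluating $F$ for each point in a list $L$ of tuples $(\theta_i,\phi_j,r^*_{ij})$. The list $L$ is constructed by doing a linear search on $r\ge0$ for each tuple $(\theta_i,\phi_j)$ to find the critical point $r^*_{ij}$, where the optimality condition for the subgradient $\partial F(r^*_{ij})$ says that $$\partial_r^-F(r^*_{ij})\le0\le\partial_r^+F(r^*_{ij}),$$ and the left and right partial derivatives of $F$ evaluated at $r=r^*_{ij}$ are $$\partial_r^-F(r^*_{ij})=\alpha-\frac{\alpha_0}n\sum_kx_k^2+\frac1n\Big[\sum_k\beta_k-\sum_{k\in K_1}\frac1{4(r^*_{ij})^2\tilde a}\Big],\qquad \partial_r^+F(r^*_{ij})=\alpha-\frac{\alpha_0}n\sum_kx_k^2+\frac1n\Big[\sum_k\beta_k-\sum_{k\in K_2}\frac1{4(r^*_{ij})^2\tilde a}\Big],$$ where $\alpha_0:=\sin\theta_i\cos\phi_j$,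 $\alpha:=\alpha_0\delta+\cos\theta_i\,\mu+\sin\theta_i\sin\phi_j(\sigma^2+\mu^2)$, $\tilde a:=\sin\theta_i(\cos\phi_j+\sin\phi_j)$, $\tilde b_k:=\sin\theta_i\cos\phi_j\,x_k-\frac12\cos\theta_i$, $\beta_k=\tilde b_k^2/\tilde a$, and $$K_1(r^*_{ij}):=\Big\{k:\Big(\frac{\tilde b_k}{\tilde a}+\frac1{4r^*_{ij}\tilde a}\Big)-\tau\ge0\Big\},\qquad K_2(r^*_{ij}):=\Big\{k:\Big(\frac{\tilde b_k}{\tilde a}+\frac1{4r^*_{ij}\tilde a}\Big)-\tau>0\Big\}.$$
   Context: Data: $n\ge1$, real numbers $x_1,\dots,x_n$, $\tau,\mu\in\mathbb{R}$, $\sigma\ge0$, $\delta\ge0$; $(z)_+=\max(z,0)$. The variables $(r,\theta,\phi)$ are spherical coordinates $\lambda_1=r\sin\theta\cos\phi\ge0$, $\lambda_2=r\cos\theta$, $\lambda_3=r\sin\theta\sin\phi$ for dual variables $(\lambda_1,\lambda_2,\lambda_3)$. The $(\theta_i,\phi_j)$ are the grid points. $\partial_r^\pm$ denote one-sided derivatives and $\partial F$ the subdifferential in $r$ with $(\theta_i,\phi_j)$ fixed. The approximate solution is the minimum of $F$ over the list $L$.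
   Formalization: The approximation claim is for finite dual value (if it is -∞, fine grids contain a direction with F unbounded below); grid angles also satisfy sinθcosφ≥0, and angles with no critical point r* add no tuple to L (existence is shown when the asymptotic slope in r is positive). *)

theory Defs
  imports "HOL-Analysis.Analysis"
begin

text \<open>
  The data are \<open>n\<close>, the sample \<open>x 1, \<dots>, x n\<close> and the reals \<open>\<tau> \<mu> \<sigma> \<delta>\<close>.
  The objective takes values in the extended reals: the inner suprema may be \<open>\<infinity>\<close>, but they
  are never \<open>-\<infinity>\<close>, so the sum below never meets \<open>\<infinity> - \<infinity>\<close>.
\<close>

definition dual_obj ::
  "nat \<Rightarrow> (nat \<Rightarrow> real) \<Rightarrow> real \<Rightarrow> real \<Rightarrow> real \<Rightarrow> real \<Rightarrow> real \<Rightarrow> real \<Rightarrow> real \<Rightarrow> ereal" where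
  "dual_obj n x \<tau> \<mu> \<sigma> \<delta> r \<theta> \<phi> =
     ereal (r * sin \<theta> * cos \<phi> * \<delta> + r * cos \<theta> * \<mu> + r * sin \<theta> * sin \<phi> * (\<sigma>\<^sup>2 + \<mu>\<^sup>2))
     + ereal (1 / real n) *
       (\<Sum>k=1..n. SUP y. ereal (max (y - \<tau>) 0 - r * sin \<theta> * cos \<phi> * (y - x k)\<^sup>2
                                - r * cos \<theta> * y - r * sin \<theta> * sin \<phi> * y\<^sup>2))"

definition angle_box :: "(real \<times> real) set" where
  "angle_box = {0..pi} \<times> {0..<2 * pi}"

definition dual_feasible :: "(real \<times> real \<times> real) set" where
  "dual_feasible = {(r, \<theta>, \<phi>). 0 \<le> r \<and> (\<theta>, \<phi>) \<in> angle_box \<and> 0 \<le> r * sin \<theta> * cos \<phi>}"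

definition dual_value :: "(real \<Rightarrow> real \<Rightarrow> real \<Rightarrow> ereal) \<Rightarrow> ereal" where
  "dual_value F = (INF (r, \<theta>, \<phi>) \<in> dual_feasible. F r \<theta> \<phi>)"

text \<open>
  Subdifferential of an extended-real function on the half-line \<open>[0, \<infinity>)\<close>; as usual in convex
  analysis it is empty at points where the function is not finite.
\<close>

definition subdifferential :: "(real \<Rightarrow> ereal) \<Rightarrow> real \<Rightarrow> real set" where
  "subdifferential f r =
     {g. 0 \<le> r \<and> \<bar>f r\<bar> \<noteq> \<infinity> \<and> (\<forall>s\<ge>0. f r + ereal (g * (s - r)) \<le> f s)}"

definition critical :: "(real \<Rightarrow> real \<Rightarrow> real \<Rightarrow> ereal) \<Rightarrow> real \<Rightarrow> real \<Rightarrow> real \<Rightarrow> bool" where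
  "critical F \<theta> \<phi> r \<longleftrightarrow> 0 \<in> subdifferential (\<lambda>s. F s \<theta> \<phi>) r"

definition alpha0 :: "real \<Rightarrow> real \<Rightarrow> real" where
  "alpha0 \<theta> \<phi> = sin \<theta> * cos \<phi>"

definition alpha :: "real \<Rightarrow> real \<Rightarrow> real \<Rightarrow> real \<Rightarrow> real \<Rightarrow> real" where
  "alpha \<mu> \<sigma> \<delta> \<theta> \<phi> = alpha0 \<theta> \<phi> * \<delta> + cos \<theta> * \<mu> + sin \<theta> * sin \<phi> * (\<sigma>\<^sup>2 + \<mu>\<^sup>2)"

definition a_tilde :: "real \<Rightarrow> real \<Rightarrow> real" where
  "a_tilde \<theta> \<phi> = sin \<theta> * (cos \<phi> + sin \<phi>)"

definition b_tilde :: "(nat \<Rightarrow> real) \<Rightarrow> real \<Rightarrow> real \<Rightarrow> nat \<Rightarrow> real" where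
  "b_tilde x \<theta> \<phi> k = sin \<theta> * cos \<phi> * x k - cos \<theta> / 2"

definition beta :: "(nat \<Rightarrow> real) \<Rightarrow> real \<Rightarrow> real \<Rightarrow> nat \<Rightarrow> real" where
  "beta x \<theta> \<phi> k = (b_tilde x \<theta> \<phi> k)\<^sup>2 / a_tilde \<theta> \<phi>"

definition K1 :: "nat \<Rightarrow> (nat \<Rightarrow> real) \<Rightarrow> real \<Rightarrow> real \<Rightarrow> real \<Rightarrow> real \<Rightarrow> nat set" where
  "K1 n x \<tau> \<theta> \<phi> r =
     {k \<in> {1..n}. (b_tilde x \<theta> \<phi> k / a_tilde \<theta> \<phi> + 1 / (4 * r * a_tilde \<theta> \<phi>)) - \<tau> \<ge> 0}"

definition K2 :: "nat \<Rightarrow> (nat \<Rightarrow> real) \<Rightarrow> real \<Rightarrow> real \<Rightarrow> real \<Rightarrow> real \<Rightarrow> nat set" where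
  "K2 n x \<tau> \<theta> \<phi> r =
     {k \<in> {1..n}. (b_tilde x \<theta> \<phi> k / a_tilde \<theta> \<phi> + 1 / (4 * r * a_tilde \<theta> \<phi>)) - \<tau> > 0}"

text \<open>
  A two-dimensional grid is the product of a list of values of \<open>\<theta>\<close> and a list of values of \<open>\<phi>\<close>,
  not necessarily equidistant; \<open>h\<close> bounds its resolution.
\<close>

definition angle_grid :: "real \<Rightarrow> real list \<Rightarrow> real list \<Rightarrow> bool" where
  "angle_grid h \<theta>s \<phi>s \<longleftrightarrow>
     set \<theta>s \<times> set \<phi>s \<subseteq> angle_box \<and>
     (\<forall>t \<in> {0..pi}. \<exists>\<theta> \<in> set \<theta>s. \<bar>t - \<theta>\<bar> < h) \<and>
     (\<forall>p \<in> {0..<2 * pi}. \<exists>\<phi> \<in> set \<phi>s. \<bar>p - \<phi>\<bar> < h)"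

text \<open>
  The search runs over the angles with \<open>sin \<theta> (cos \<phi> + sin \<phi>) > 0\<close>; the constraint
  \<open>\<lambda>\<^sub>1 = r sin \<theta> cos \<phi> \<ge> 0\<close> of the dual problem remains in force.
\<close>

definition admissible :: "real \<Rightarrow> real \<Rightarrow> bool" where
  "admissible \<theta> \<phi> \<longleftrightarrow> 0 \<le> sin \<theta> * cos \<phi> \<and> 0 < sin \<theta> * (cos \<phi> + sin \<phi>)"

text \<open>
  \<open>rs\<close> is the outcome of the linear searches in \<open>r\<close>: at every grid point for which the function
  \<open>r \<mapsto> F r \<theta> \<phi>\<close> has a critical point, \<open>rs \<theta> \<phi>\<close> is such a point.  There are directions without
  one (when \<open>F\<close> keeps decreasing as \<open>r \<rightarrow> \<infinity>\<close>); these contribute no tuple to the search list.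
\<close>

definition linear_search ::
  "(real \<Rightarrow> real \<Rightarrow> real \<Rightarrow> ereal) \<Rightarrow> real list \<Rightarrow> real list \<Rightarrow> (real \<Rightarrow> real \<Rightarrow> real) \<Rightarrow> bool" where
  "linear_search F \<theta>s \<phi>s rs \<longleftrightarrow>
     (\<forall>\<theta> \<in> set \<theta>s. \<forall>\<phi> \<in> set \<phi>s.
        admissible \<theta> \<phi> \<longrightarrow> (\<exists>r. critical F \<theta> \<phi> r) \<longrightarrow> critical F \<theta> \<phi> (rs \<theta> \<phi>))"

definition search_list ::
  "(real \<Rightarrow> real \<Rightarrow> real \<Rightarrow> ereal) \<Rightarrow> real list \<Rightarrow> real list \<Rightarrow> (real \<Rightarrow> real \<Rightarrow> real)
     \<Rightarrow> (real \<times> real \<times> real) list" where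
  "search_list F \<theta>s \<phi>s rs =
     [(\<theta>, \<phi>, rs \<theta> \<phi>). \<theta> \<leftarrow> \<theta>s, \<phi> \<leftarrow> \<phi>s, admissible \<theta> \<phi> \<and> critical F \<theta> \<phi> (rs \<theta> \<phi>)]"

text \<open>Only meaningful for a nonempty list.\<close>

definition list_min ::
  "(real \<Rightarrow> real \<Rightarrow> real \<Rightarrow> ereal) \<Rightarrow> (real \<times> real \<times> real) list \<Rightarrow> ereal" where
  "list_min F L = Min ((\<lambda>(\<theta>, \<phi>, r). F r \<theta> \<phi>) ` set L)"

end

theory Submission
  imports Defs
begin

text \<open>
  Write \<open>a = a_tilde \<theta> \<phi>\<close> and \<open>b k = b_tilde x \<theta> \<phi> k\<close>.  The hinge \<open>max (y - \<tau>) 0\<close> is the larger of the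
  two affine functions \<open>0\<close> and \<open>y - \<tau>\<close>, so each inner supremum is the larger of two suprema of
  quadratics with leading coefficient \<open>- r a\<close>.  If \<open>r a > 0\<close>, completing the squares gives the
  closed form
    \<open>F r \<theta> \<phi> = slope * r + 1/n * (\<Sum>k. max 0 (b k / a - \<tau> + 1 / (4 a r)))\<close>,
  and if \<open>r a \<le> 0\<close> the suprema, hence \<open>F\<close>, are infinite.  Along a ray the objective is thus a
  linear function plus hinges that decrease convexly in \<open>r\<close>.  Everything about one direction is
  read off from this shape: a hinge at its kink is active to the left of \<open>r\<close> but not
  to the right, which is the difference between \<open>K1\<close> and \<open>K2\<close>; both one-sided derivatives are
  subgradients, so their signs characterise the critical points; and if the slope is positive,
  \<open>F\<close> blows up at both ends of the ray and has exactly one minimizer.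

  For the grid search the sign of the slope decides.  A negative slope at an admissible direction
  makes the dual value \<open>-\<infinity>\<close>; if no admissible direction has one, then \<open>F \<ge> 0\<close> on the whole
  feasible set.  So the dual value \<open>-\<infinity>\<close> is witnessed by a direction of negative slope, and a
  finite one forces all admissible slopes to be nonnegative.  Where \<open>a > 0\<close>, the slope and, for fixed
  \<open>r > 0\<close>, the objective depend continuously on the direction, and the aim is an open set of good
  directions, since every fine grid meets it (\<open>angle_grid_meets_neighbourhood\<close>).  Two perturbations lead there.  First,
  \<open>admissible\<close> contains the closed condition \<open>cos \<phi> \<ge> 0\<close>, but where \<open>cos \<phi> = 0\<close>, lowering \<open>\<phi>\<close> slightly
  makes it strict (\<open>eventually_admissible_near\<close>).  Second, a direction of slope \<open>0\<close> need not have a critical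
  point and then contributes nothing to the search list; but for fixed \<open>\<phi>\<close> the slope is \<open>sin \<theta>\<close>
  times a quadratic in \<open>cot \<theta>\<close> with leading coefficient \<open>1 / (4 (cos \<phi> + sin \<phi>))\<close>, so it vanishes
  for at most two values of \<open>\<theta>\<close>, and a small change of \<open>\<theta>\<close> makes it positive
  (\<open>eventually_nonzero_slope_near\<close>).  At a grid point in the resulting open set the critical point
  exists and minimizes over the ray, so its value is at most that of the nearly optimal \<open>r\<close> with
  which the construction began.
\<close>

section \<open>The inner suprema\<close>

text \<open>
  Apart from the terms without \<open>y\<close> the objective is \<open>max (y - t) 0 - a y\<^sup>2 + 2 b y\<close>.  Its two branches
  are concave parabolas with maxima at \<open>b / a\<close> and \<open>(b + 1 / 2) / a\<close>, and each branch is a lower bound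
  for the objective everywhere, so the larger of the two maxima is the supremum.
\<close>

lemma SUP_hinge_quadratic:
  fixes A B C t z :: real
  assumes "A + C > 0"
  defines "a \<equiv> A + C" and "b \<equiv> A * z - B / 2"
  shows "(SUP y. ereal (max (y - t) 0 - A * (y - z)\<^sup>2 - B * y - C * y\<^sup>2))
           = ereal (b\<^sup>2 / a - A * z\<^sup>2 + max 0 (b / a - t + 1 / (4 * a)))"
    (is "(SUP y. ereal (?h y)) = ereal ?v")
proof -
  have a: "a > 0" using assms by simp
  have h: "?h y = max (y - t) 0 - a * y\<^sup>2 + 2 * b * y - A * z\<^sup>2" for y
    by (simp add: a_def b_def algebra_simps power2_eq_square)
  have square0: "b\<^sup>2 / a - (- a * y\<^sup>2 + 2 * b * y) = (a * y - b)\<^sup>2 / a" for y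
    using a by (simp add: field_simps power2_eq_square)
  have square1: "b\<^sup>2 / a + b / a + 1 / (4 * a) - (y - a * y\<^sup>2 + 2 * b * y)
      = (a * y - b - 1 / 2)\<^sup>2 / a" for y
    using a by (simp add: field_simps power2_eq_square)
  have ub: "?h y \<le> ?v" for y
  proof -
    have "0 \<le> (a * y - b)\<^sup>2 / a" "0 \<le> (a * y - b - 1 / 2)\<^sup>2 / a" using a by simp_all
    then show ?thesis unfolding h square0[symmetric] square1[symmetric] by linarith
  qed
  have lb0: "?h (b / a) \<ge> b\<^sup>2 / a - A * z\<^sup>2"
    using square0[of "b / a"] a unfolding h by simp
  have lb1: "?h ((b + 1 / 2) / a) \<ge> b\<^sup>2 / a - A * z\<^sup>2 + (b / a - t + 1 / (4 * a))"
    using square1[of "(b + 1 / 2) / a"] a unfolding h by simp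
  have "\<exists>y. ?v \<le> ?h y"
  proof (cases "b / a - t + 1 / (4 * a) \<ge> 0")
    case True
    then show ?thesis using lb1 by (intro exI[of _ "(b + 1 / 2) / a"]) (simp only: max_absorb2)
  next
    case False
    then have "max 0 (b / a - t + 1 / (4 * a)) = 0" by simp
    then show ?thesis using lb0 by (intro exI[of _ "b / a"]) (simp only: add_0_right)
  qed
  then obtain y where y: "?v \<le> ?h y" by blast
  show ?thesis
  proof (rule antisym)
    show "(SUP y. ereal (?h y)) \<le> ereal ?v" using ub by (intro SUP_least) simp
    show "ereal ?v \<le> (SUP y. ereal (?h y))" using y by (intro SUP_upper2[of y]) simp_all
  qed
qed

text \<open>
  Without a concave quadratic term the objective is at least \<open>max (y - t) 0 + 2 b y\<close> up to a constant.
  The hinge makes it unbounded on the right if \<open>b \<ge> 0\<close>, the linear term on the left if \<open>b < 0\<close>.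
\<close>

lemma SUP_hinge_quadratic_infinite:
  fixes A B C t z :: real
  assumes "A + C \<le> 0"
  shows "(SUP y. ereal (max (y - t) 0 - A * (y - z)\<^sup>2 - B * y - C * y\<^sup>2)) = \<infinity>"
    (is "(SUP y. ereal (?h y)) = \<infinity>")
proof (rule SUP_PInfty)
  fix N :: nat
  define b where "b = A * z - B / 2"
  have h: "?h y \<ge> max (y - t) 0 + 2 * b * y - A * z\<^sup>2" for y
  proof -
    have "?h y = max (y - t) 0 - (A + C) * y\<^sup>2 + 2 * b * y - A * z\<^sup>2"
      by (simp add: b_def algebra_simps power2_eq_square)
    moreover have "(A + C) * y\<^sup>2 \<le> 0" using assms by (simp add: mult_nonpos_nonneg)
    ultimately show ?thesis by linarith
  qed
  show "\<exists>y\<in>UNIV. ereal (real N) \<le> ereal (?h y)"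
  proof (cases "b \<ge> 0")
    case True
    define y where "y = \<bar>real N + t + A * z\<^sup>2\<bar>"
    have "0 \<le> 2 * b * y" using True by (simp add: y_def)
    then have "real N \<le> ?h y" using h[of y] unfolding y_def by linarith
    then show ?thesis by auto
  next
    case False
    define y where "y = (real N + A * z\<^sup>2) / (2 * b)"
    have "2 * b * y = real N + A * z\<^sup>2" using False by (simp add: y_def)
    then have "real N \<le> ?h y" using h[of y] by linarith
    then show ?thesis by auto
  qed
qed

section \<open>A linear function plus decreasing hinges\<close>

locale hinge_ray =
  fixes s w c :: real and I :: "nat set" and m :: "nat \<Rightarrow> real"
  assumes finite_I: "finite I" and w_pos: "0 < w" and c_pos: "0 < c"
begin

definition f :: "real \<Rightarrow> real" where
  "f r = s * r + w * (\<Sum>k\<in>I. max 0 (m k + c / r))"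

text \<open>
  The derivative at \<open>r\<close> of the function in which the hinges of \<open>J\<close> are replaced by their argument
  and the others by \<open>0\<close>.
\<close>

definition slope_on :: "nat set \<Rightarrow> real \<Rightarrow> real" where
  "slope_on J r = s - w * (\<Sum>k\<in>J. c / r\<^sup>2)"

abbreviation weakly_active :: "real \<Rightarrow> nat set" where
  "weakly_active r \<equiv> {k \<in> I. 0 \<le> m k + c / r}"

abbreviation strictly_active :: "real \<Rightarrow> nat set" where
  "strictly_active r \<equiv> {k \<in> I. 0 < m k + c / r}"

lemma slope_on_eq: "J \<subseteq> I \<Longrightarrow> slope_on J r = s - w * (\<Sum>k\<in>I. if k \<in> J then c / r\<^sup>2 else 0)"
  unfolding slope_on_def using finite_I by (simp add: sum.inter_restrict[symmetric] Int_absorb1 Int_commute)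

text \<open>
  To the left of \<open>r\<close> the argument of the hinge is larger than at \<open>r\<close>, so a hinge at its kink counts
  as active.
\<close>

lemma hinge_left_derivative:
  assumes "0 < r"
  shows "((\<lambda>q. max 0 (m k + c / q)) has_real_derivative
           (if 0 \<le> m k + c / r then - (c / r\<^sup>2) else 0)) (at_left r)"
proof (cases "0 \<le> m k + c / r")
  case True
  have "\<forall>\<^sub>F q in at_left r. 0 < q \<and> q < r"
    using assms by (simp add: eventually_at_left_field) (metis assms)
  then have "\<forall>\<^sub>F q in at_left r. max 0 (m k + c / q) = m k + c / q"
  proof eventually_elim
    case (elim q)
    then have "c / r \<le> c / q" using c_pos by (simp add: frac_le)
    then show ?case using True by simp
  qed
  moreover have "((\<lambda>q. m k + c / q) has_real_derivative - (c / r\<^sup>2)) (at_left r)"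
    using assms by (auto intro!: derivative_eq_intros simp: power2_eq_square)
  ultimately show ?thesis
    using True by (subst has_field_derivative_cong_eventually) auto
next
  case False
  have "((\<lambda>q. m k + c / q) \<longlongrightarrow> m k + c / r) (at_left r)"
    using assms by (intro tendsto_intros) auto
  then have "\<forall>\<^sub>F q in at_left r. m k + c / q < 0"
    using False by (intro order_tendstoD) auto
  then have "\<forall>\<^sub>F q in at_left r. max 0 (m k + c / q) = 0"
    by eventually_elim simp
  then show ?thesis
    using False by (subst has_field_derivative_cong_eventually[where g = "\<lambda>_. 0"]) auto
qed

lemma hinge_right_derivative:
  assumes "0 < r"
  shows "((\<lambda>q. max 0 (m k + c / q)) has_real_derivative
           (if 0 < m k + c / r then - (c / r\<^sup>2) else 0)) (at_right r)"
proof (cases "0 < m k + c / r")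
  case True
  have "((\<lambda>q. m k + c / q) \<longlongrightarrow> m k + c / r) (at_right r)"
    using assms by (intro tendsto_intros) auto
  then have "\<forall>\<^sub>F q in at_right r. 0 < m k + c / q"
    using True by (intro order_tendstoD) auto
  then have "\<forall>\<^sub>F q in at_right r. max 0 (m k + c / q) = m k + c / q"
    by eventually_elim simp
  moreover have "((\<lambda>q. m k + c / q) has_real_derivative - (c / r\<^sup>2)) (at_right r)"
    using assms by (auto intro!: derivative_eq_intros simp: power2_eq_square)
  ultimately show ?thesis
    using True by (subst has_field_derivative_cong_eventually) auto
next
  case False
  have "\<forall>\<^sub>F q in at_right r. r < q"
    by (simp add: eventually_at_right_less)
  then have "\<forall>\<^sub>F q in at_right r. max 0 (m k + c / q) = 0"
  proof eventually_elim
    case (elim q)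
    then have "c / q \<le> c / r" using c_pos assms by (simp add: frac_le)
    then show ?case using False by simp
  qed
  then show ?thesis
    using False by (subst has_field_derivative_cong_eventually[where g = "\<lambda>_. 0"]) auto
qed

lemma left_derivative:
  assumes "0 < r"
  shows "(f has_real_derivative slope_on (weakly_active r) r) (at_left r)"
proof -
  have "((\<lambda>q. s * q + w * (\<Sum>k\<in>I. max 0 (m k + c / q))) has_real_derivative
      s * 1 + w * (\<Sum>k\<in>I. if 0 \<le> m k + c / r then - (c / r\<^sup>2) else 0)) (at_left r)"
    using hinge_left_derivative[OF assms]
    by (intro DERIV_add DERIV_cmult DERIV_sum DERIV_ident) auto
  also have "s * 1 + w * (\<Sum>k\<in>I. if 0 \<le> m k + c / r then - (c / r\<^sup>2) else 0)
      = slope_on (weakly_active r) r"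
    unfolding slope_on_def using finite_I
    by (simp add: sum.inter_filter[symmetric] sum_negf)
  finally show ?thesis unfolding f_def[abs_def] .
qed

lemma right_derivative:
  assumes "0 < r"
  shows "(f has_real_derivative slope_on (strictly_active r) r) (at_right r)"
proof -
  have "((\<lambda>q. s * q + w * (\<Sum>k\<in>I. max 0 (m k + c / q))) has_real_derivative
      s * 1 + w * (\<Sum>k\<in>I. if 0 < m k + c / r then - (c / r\<^sup>2) else 0)) (at_right r)"
    using hinge_right_derivative[OF assms]
    by (intro DERIV_add DERIV_cmult DERIV_sum DERIV_ident) auto
  also have "s * 1 + w * (\<Sum>k\<in>I. if 0 < m k + c / r then - (c / r\<^sup>2) else 0)
      = slope_on (strictly_active r) r"
    unfolding slope_on_def using finite_I
    by (simp add: sum.inter_filter[symmetric] sum_negf)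
  finally show ?thesis unfolding f_def[abs_def] .
qed

text \<open>
  The tangent of the convex function \<open>q \<mapsto> c / q\<close> lies below it.  At a hinge with value exactly \<open>0\<close>
  both the tangent and the constant \<open>0\<close> are supporting lines, hence the freedom in \<open>J\<close>, which
  covers the left and the right derivative at once.
\<close>

lemma slope_on_subgradient:
  assumes "0 < r" "0 < q" and J: "strictly_active r \<subseteq> J" "J \<subseteq> weakly_active r"
  shows "f r + slope_on J r * (q - r) \<le> f q"
proof -
  have tangent: "c / r - c / r\<^sup>2 * (q - r) \<le> c / q"
  proof -
    have "c / q - (c / r - c / r\<^sup>2 * (q - r)) = c * (q - r)\<^sup>2 / (q * r\<^sup>2)"
      using assms by (simp add: field_simps power2_eq_square)
    moreover have "\<dots> \<ge> 0" using c_pos assms by simp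
    ultimately show ?thesis by linarith
  qed
  have "max 0 (m k + c / r) - (if k \<in> J then c / r\<^sup>2 else 0) * (q - r) \<le> max 0 (m k + c / q)"
    if "k \<in> I" for k
  proof (cases "k \<in> J")
    case True
    then have "0 \<le> m k + c / r" using J by auto
    then show ?thesis using True tangent by simp
  next
    case False
    then have "m k + c / r \<le> 0" using J that by force
    then show ?thesis using False by simp
  qed
  then have "(\<Sum>k\<in>I. max 0 (m k + c / r) - (if k \<in> J then c / r\<^sup>2 else 0) * (q - r))
      \<le> (\<Sum>k\<in>I. max 0 (m k + c / q))"
    by (rule sum_mono)
  then have "w * ((\<Sum>k\<in>I. max 0 (m k + c / r)) - (\<Sum>k\<in>I. if k \<in> J then c / r\<^sup>2 else 0) * (q - r))
      \<le> w * (\<Sum>k\<in>I. max 0 (m k + c / q))"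
    using w_pos by (simp add: sum_subtractf sum_distrib_right)
  moreover have "J \<subseteq> I" using J by auto
  ultimately show ?thesis unfolding f_def slope_on_eq[OF \<open>J \<subseteq> I\<close>] by (simp add: algebra_simps)
qed

definition minimizer :: "real \<Rightarrow> bool" where
  "minimizer r \<longleftrightarrow> 0 < r \<and> (\<forall>q>0. f r \<le> f q)"

lemma minimizer_iff_slopes:
  assumes "0 < r"
  shows "minimizer r \<longleftrightarrow>
           slope_on (weakly_active r) r \<le> 0 \<and> 0 \<le> slope_on (strictly_active r) r"
proof (intro iffI conjI)
  assume min: "minimizer r"
  show "slope_on (weakly_active r) r \<le> 0"
  proof (rule ccontr)
    assume "\<not> ?thesis"
    then obtain d where d: "d > 0" "\<And>h. 0 < h \<Longrightarrow> h < d \<Longrightarrow> f (r - h) < f r"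
      using has_real_derivative_pos_inc_left[OF left_derivative[OF assms]] by auto
    define h where "h = min d r / 2"
    have "0 < h" "h < d" "h < r" using d assms by (auto simp: h_def)
    then show False using d(2)[of h] min unfolding minimizer_def by (smt (verit))
  qed
  show "0 \<le> slope_on (strictly_active r) r"
  proof (rule ccontr)
    assume "\<not> ?thesis"
    then obtain d where d: "d > 0" "\<And>h. 0 < h \<Longrightarrow> h < d \<Longrightarrow> f (r + h) < f r"
      using has_real_derivative_neg_dec_right[OF right_derivative[OF assms]] by auto
    then show False using d(2)[of "d / 2"] min assms unfolding minimizer_def by (smt (verit) half_gt_zero field_sum_of_halves)
  qed
next
  assume slopes: "slope_on (weakly_active r) r \<le> 0 \<and> 0 \<le> slope_on (strictly_active r) r"
  have "f r \<le> f q" if "0 < q" for q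
  proof (cases "q \<le> r")
    case True
    then have "0 \<le> slope_on (weakly_active r) r * (q - r)"
      using slopes by (simp add: mult_nonpos_nonpos)
    then show ?thesis using slope_on_subgradient[OF assms that, of "weakly_active r"] by force
  next
    case False
    then have "0 \<le> slope_on (strictly_active r) r * (q - r)"
      using slopes by simp
    then show ?thesis using slope_on_subgradient[OF assms that, of "strictly_active r"] by force
  qed
  then show "minimizer r" using assms by (simp add: minimizer_def)
qed

text \<open>
  Every hinge weakly active at the larger point \<open>q\<close> is strictly active at the smaller point \<open>p\<close>.
  With \<open>N\<close> the number of hinges weakly active at \<open>q\<close>, the conditions on the one-sided slopes give
  \<open>s p\<^sup>2 \<ge> w N c \<ge> s q\<^sup>2\<close>, which is absurd.
\<close>

lemma minimizer_unique:
  assumes "0 < s" "minimizer p" "minimizer q"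
  shows "p = q"
proof -
  have False if "minimizer p" "minimizer q" "p < q" for p q
  proof -
    have pos: "0 < p" "0 < q" using that by (auto simp: minimizer_def)
    define N where "N = real (card (weakly_active q))"
    have "weakly_active q \<subseteq> strictly_active p"
    proof
      fix k assume "k \<in> weakly_active q"
      moreover have "c / q < c / p" using c_pos pos that(3) by (simp add: frac_less2)
      ultimately show "k \<in> strictly_active p" by auto
    qed
    then have "N \<le> real (card (strictly_active p))"
      unfolding N_def using finite_I by (simp add: card_mono)
    then have "w * (N * (c / p\<^sup>2)) \<le> w * (real (card (strictly_active p)) * (c / p\<^sup>2))"
      using w_pos c_pos by (intro mult_left_mono mult_right_mono) auto
    then have at_p: "w * N * c \<le> s * p\<^sup>2"
      using minimizer_iff_slopes[OF pos(1)] that(1) pos by (simp add: slope_on_def field_simps)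
    have at_q: "s * q\<^sup>2 \<le> w * N * c"
      using minimizer_iff_slopes[OF pos(2)] that(2) pos by (simp add: slope_on_def N_def field_simps)
    have "p\<^sup>2 < q\<^sup>2" using pos that(3) by (simp add: power_strict_mono)
    then have "s * p\<^sup>2 < s * q\<^sup>2" using assms(1) by simp
    then show False using at_p at_q by linarith
  qed
  then show ?thesis using assms(2,3) by (meson linorder_neqE)
qed

text \<open>
  One hinge forces \<open>f\<close> above \<open>v = f 1\<close> near \<open>0\<close>, and the linear term does so beyond \<open>v / s\<close>; on the
  compact interval in between, which contains \<open>1\<close>, the minimum is attained.
\<close>

lemma minimizer_exists:
  assumes "0 < s" "I \<noteq> {}"
  shows "\<exists>r. minimizer r"
proof -
  obtain k where k: "k \<in> I" using assms by auto
  have f_ge: "s * r + w * max 0 (m k + c / r) \<le> f r" for r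
    unfolding f_def using w_pos member_le_sum[OF k _ finite_I, of "\<lambda>k. max 0 (m k + c / r)"] by simp
  define v where "v = f 1"
  define R where "R = max 1 (v / s)"
  \<comment> \<open>For \<open>q < e\<close> the term \<open>w (c / q)\<close> exceeds \<open>D\<close> and so outweighs both \<open>v\<close> and
    \<open>w (m k)\<close>; the summand \<open>w c\<close> keeps \<open>D\<close> positive and \<open>e \<le> 1\<close>.\<close>
  define D where "D = \<bar>v\<bar> + w * \<bar>m k\<bar> + w * c"
  define e where "e = w * c / D"
  have wc: "0 < w * c" using w_pos c_pos by simp
  have D: "0 < D" "w * c \<le> D" unfolding D_def using w_pos wc by (auto intro: add_nonneg_pos)
  have e: "0 < e" "e \<le> 1" unfolding e_def using D wc by auto
  have "continuous_on {e..R} f"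
    unfolding f_def[abs_def] using e by (intro continuous_intros) auto
  moreover have "e \<le> R" using e by (simp add: R_def)
  ultimately obtain r where r: "r \<in> {e..R}" "\<And>q. q \<in> {e..R} \<Longrightarrow> f r \<le> f q"
    using continuous_attains_inf[of "{e..R}" f] by auto
  have le_v: "f r \<le> v" unfolding v_def using e by (intro r(2)) (auto simp: R_def)
  have "f r \<le> f q" if "0 < q" for q
  proof -
    consider "q < e" | "q > R" | "q \<in> {e..R}" by force
    then show ?thesis
    proof cases
      case 1
      then have "D * q < w * c" using D by (simp add: e_def field_simps)
      then have "D < w * (c / q)" using that by (simp add: field_simps)
      moreover have "w * (m k + c / q) \<le> w * max 0 (m k + c / q)" using w_pos by simp
      moreover have "- (w * \<bar>m k\<bar>) \<le> w * m k" using w_pos mult_left_mono[of "- \<bar>m k\<bar>" "m k" w] by simp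
      moreover have "0 \<le> s * q" using assms that by simp
      ultimately have "v \<le> f q"
        using f_ge[of q] wc unfolding D_def by (simp add: distrib_left)
      then show ?thesis using le_v by simp
    next
      case 2
      then have "v \<le> s * q" using assms(1) unfolding R_def by (simp add: field_simps)
      moreover have "0 \<le> w * max 0 (m k + c / q)" using w_pos by simp
      ultimately show ?thesis using f_ge[of q] le_v by linarith
    qed (use r in auto)
  qed
  moreover have "0 < r" using r(1) e by simp
  ultimately show ?thesis unfolding minimizer_def by blast
qed

lemma f_nonneg: "0 \<le> s \<Longrightarrow> 0 < r \<Longrightarrow> 0 \<le> f r"
  unfolding f_def using w_pos by (intro add_nonneg_nonneg mult_nonneg_nonneg sum_nonneg) auto

lemma f_unbounded_below:
  assumes "s < 0"
  shows "\<exists>r>0. f r \<le> B"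
proof -
  define V where "V = w * (\<Sum>k\<in>I. max 0 (m k + c))"
  define r where "r = max 1 ((B - V) / s)"
  have r: "1 \<le> r" by (simp add: r_def)
  have "s * r \<le> s * ((B - V) / s)" using assms by (intro mult_left_mono_neg) (auto simp: r_def)
  then have "s * r \<le> B - V" using assms by simp
  moreover have "c / r \<le> c" using r c_pos by (simp add: field_simps)
  then have "w * (\<Sum>k\<in>I. max 0 (m k + c / r)) \<le> V"
    unfolding V_def using w_pos by (intro mult_left_mono sum_mono) auto
  ultimately have "f r \<le> B" unfolding f_def by linarith
  then show ?thesis using r by (intro exI[of _ r]) auto
qed

end

section \<open>Grid points in open sets of directions\<close>

lemma eventually_nhds_prod_real:
  fixes a b :: real
  assumes "\<forall>\<^sub>F q in nhds (a, b). P q"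
  obtains d where "0 < d" "\<And>s t. \<bar>a - s\<bar> < d \<Longrightarrow> \<bar>b - t\<bar> < d \<Longrightarrow> P (s, t)"
proof -
  obtain A B where A: "\<forall>\<^sub>F s in nhds a. A s" and B: "\<forall>\<^sub>F t in nhds b. B t"
    and P: "\<And>s t. A s \<Longrightarrow> B t \<Longrightarrow> P (s, t)"
    using assms unfolding nhds_prod eventually_prod_filter by blast
  obtain d where "0 < d" "\<And>s. dist s a < d \<Longrightarrow> A s" using A unfolding eventually_nhds_metric by blast
  moreover obtain e where "0 < e" "\<And>t. dist t b < e \<Longrightarrow> B t" using B unfolding eventually_nhds_metric by blast
  ultimately show thesis
    using P by (intro that[of "min d e"]) (auto simp: dist_real_def abs_minus_commute)
qed

lemma angle_grid_meets_neighbourhood: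
  assumes "(\<theta>, \<phi>) \<in> angle_box" "\<forall>\<^sub>F q in nhds (\<theta>, \<phi>). P q"
  obtains h where "0 < h"
    "\<And>\<theta>s \<phi>s. angle_grid h \<theta>s \<phi>s \<Longrightarrow> \<exists>t\<in>set \<theta>s. \<exists>p\<in>set \<phi>s. (t, p) \<in> angle_box \<and> P (t, p)"
proof -
  obtain h where h: "0 < h" "\<And>s t. \<bar>\<theta> - s\<bar> < h \<Longrightarrow> \<bar>\<phi> - t\<bar> < h \<Longrightarrow> P (s, t)"
    using eventually_nhds_prod_real[OF assms(2)] by blast
  show thesis
  proof (rule that[OF h(1)])
    fix \<theta>s \<phi>s assume grid: "angle_grid h \<theta>s \<phi>s"
    obtain t where t: "t \<in> set \<theta>s" "\<bar>\<theta> - t\<bar> < h"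
      using grid assms(1) unfolding angle_grid_def angle_box_def by blast
    obtain p where p: "p \<in> set \<phi>s" "\<bar>\<phi> - p\<bar> < h"
      using grid assms(1) unfolding angle_grid_def angle_box_def by blast
    have "(t, p) \<in> angle_box" using grid t(1) p(1) unfolding angle_grid_def by blast
    then show "\<exists>t\<in>set \<theta>s. \<exists>p\<in>set \<phi>s. (t, p) \<in> angle_box \<and> P (t, p)" using t p h(2) by blast
  qed
qed

lemma admissible_a_tilde: "admissible \<theta> \<phi> \<Longrightarrow> 0 < a_tilde \<theta> \<phi>"
  by (simp add: admissible_def a_tilde_def)

lemma sin_pos_if_admissible:
  assumes "(\<theta>, \<phi>) \<in> angle_box" "admissible \<theta> \<phi>"
  shows "0 < sin \<theta>"
proof -
  have "0 \<le> sin \<theta>" using assms(1) by (auto simp: angle_box_def intro: sin_ge_zero)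
  moreover have "sin \<theta> \<noteq> 0" using assms(2) by (auto simp: admissible_def)
  ultimately show ?thesis by simp
qed

lemma eventually_a_tilde_pos:
  assumes "0 < a_tilde \<theta> \<phi>"
  shows "\<forall>\<^sub>F q in nhds (\<theta>, \<phi>). 0 < a_tilde (fst q) (snd q)"
proof -
  have "isCont (\<lambda>q. a_tilde (fst q) (snd q)) (\<theta>, \<phi>)"
    unfolding a_tilde_def by (intro continuous_intros)
  then have "((\<lambda>q. a_tilde (fst q) (snd q)) \<longlongrightarrow> a_tilde \<theta> \<phi>) (nhds (\<theta>, \<phi>))"
    by (simp add: isCont_def tendsto_nhds_iff)
  then show ?thesis using assms by (rule order_tendstoD)
qed

text \<open>
  The condition \<open>cos \<phi> \<ge> 0\<close> defines a closed set, so an admissible direction with \<open>cos \<phi> = 0\<close> has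
  inadmissible neighbours.  There \<open>sin \<phi> > 0\<close>, because \<open>cos \<phi> + sin \<phi> > 0\<close>; hence the cosine decreases
  at \<open>\<phi>\<close>, and a slightly smaller angle has a positive cosine.  Since \<open>\<phi> \<noteq> 0\<close>, that angle stays in
  the box.
\<close>

lemma eventually_admissible_near:
  assumes box: "(\<theta>, \<phi>) \<in> angle_box" and adm: "admissible \<theta> \<phi>"
    and P: "\<forall>\<^sub>F q in nhds (\<theta>, \<phi>). P q"
  obtains p where "(\<theta>, p) \<in> angle_box" "admissible \<theta> p"
    "\<forall>\<^sub>F q in nhds (\<theta>, p). P q \<and> admissible (fst q) (snd q)"
proof -
  have sin: "0 < sin \<theta>" by (rule sin_pos_if_admissible[OF box adm])
  have open_adm: "\<forall>\<^sub>F q in nhds (\<theta>, p). admissible (fst q) (snd q)"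
    if "0 < cos p" "0 < a_tilde \<theta> p" for p
  proof -
    have "((\<lambda>q. sin (fst q) * cos (snd q)) \<longlongrightarrow> sin \<theta> * cos p) (nhds (\<theta>, p))"
      using tendsto_fst[OF filterlim_ident, of "(\<theta>, p)"] tendsto_snd[OF filterlim_ident, of "(\<theta>, p)"]
      by (intro tendsto_mult tendsto_sin tendsto_cos) simp_all
    moreover have "0 < sin \<theta> * cos p" using sin that by simp
    ultimately have "\<forall>\<^sub>F q in nhds (\<theta>, p). 0 < sin (fst q) * cos (snd q)"
      by (rule order_tendstoD)
    with eventually_a_tilde_pos[OF that(2)] show ?thesis
      by eventually_elim (auto simp: admissible_def a_tilde_def)
  qed
  have cos: "0 \<le> cos \<phi>" using adm sin by (simp add: admissible_def zero_le_mult_iff)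
  obtain p where p: "(\<theta>, p) \<in> angle_box" "0 < cos p" "\<forall>\<^sub>F q in nhds (\<theta>, p). P q \<and> 0 < a_tilde (fst q) (snd q)"
  proof (cases "cos \<phi> = 0")
    case False
    show thesis
      by (rule that[of \<phi>])
        (use False cos box P eventually_a_tilde_pos[OF admissible_a_tilde[OF adm]] in
          \<open>auto simp: eventually_conj_iff\<close>)
  next
    case True
    have "0 < sin \<phi>" using adm True sin by (simp add: admissible_def zero_less_mult_iff)
    moreover have "(cos has_real_derivative - sin \<phi>) (at \<phi>)" by (rule DERIV_cos)
    ultimately obtain d where d: "0 < d" "\<And>h. 0 < h \<Longrightarrow> h < d \<Longrightarrow> cos \<phi> < cos (\<phi> - h)"
      using DERIV_neg_dec_left[of cos "- sin \<phi>" \<phi>] by auto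
    have "\<phi> \<noteq> 0" using True by auto
    then have \<phi>: "0 < \<phi>" using box by (auto simp: angle_box_def)
    \<comment> \<open>The properties must hold in a whole neighbourhood of the new point, not only at it.\<close>
    have "\<forall>\<^sub>F q in nhds (\<theta>, \<phi>). \<forall>\<^sub>F q in nhds q. P q \<and> 0 < a_tilde (fst q) (snd q)"
      using P eventually_a_tilde_pos[OF admissible_a_tilde[OF adm]]
      unfolding eventually_eventually by (simp add: eventually_conj_iff)
    then obtain e where e: "0 < e" "\<And>s t. \<bar>\<theta> - s\<bar> < e \<Longrightarrow> \<bar>\<phi> - t\<bar> < e \<Longrightarrow>
        \<forall>\<^sub>F q in nhds (s, t). P q \<and> 0 < a_tilde (fst q) (snd q)"
      using eventually_nhds_prod_real by blast
    define h where "h = min (min d e) \<phi> / 2"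
    have h: "0 < h" "h < d" "h < e" "h < \<phi>" using d(1) e(1) \<phi> by (auto simp: h_def)
    show thesis
    proof (rule that[of "\<phi> - h"])
      show "(\<theta>, \<phi> - h) \<in> angle_box" using box h by (auto simp: angle_box_def)
      show "0 < cos (\<phi> - h)" using d(2)[OF h(1,2)] True by simp
      show "\<forall>\<^sub>F q in nhds (\<theta>, \<phi> - h). P q \<and> 0 < a_tilde (fst q) (snd q)"
        using h e by (intro e(2)) auto
    qed
  qed
  have a: "0 < a_tilde \<theta> p" using eventually_nhds_x_imp_x[OF p(3)] by simp
  show thesis
  proof (rule that[OF p(1)])
    show "admissible \<theta> p" using eventually_nhds_x_imp_x[OF open_adm[OF p(2) a]] by simp
    show "\<forall>\<^sub>F q in nhds (\<theta>, p). P q \<and> admissible (fst q) (snd q)"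
      using open_adm[OF p(2) a] p(3) by eventually_elim auto
  qed
qed

lemma inj_on_cot_0_pi: "inj_on (\<lambda>t::real. cos t / sin t) {0<..<pi}"
proof (rule inj_onI)
  fix s t :: real
  assume st: "s \<in> {0<..<pi}" "t \<in> {0<..<pi}" "cos s / sin s = cos t / sin t"
  have "0 < sin s" "0 < sin t" using st by (auto intro: sin_gt_zero)
  then have "sin (t - s) = 0" using st(3) by (simp add: sin_diff field_simps)
  moreover have "- pi < t - s" "t - s < pi" using st by auto
  ultimately show "s = t" using sin_eq_0_pi by fastforce
qed

lemma quadratic_three_roots:
  fixes p q c :: real
  assumes "p + q * u + c * u\<^sup>2 = 0" "p + q * v + c * v\<^sup>2 = 0" "p + q * w + c * w\<^sup>2 = 0"
    and "u \<noteq> v" "v \<noteq> w" "u \<noteq> w"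
  shows "c = 0"
proof -
  have "(u - v) * (q + c * (u + v)) = 0" "(u - w) * (q + c * (u + w)) = 0"
    using assms(1-3) by (simp_all add: algebra_simps power2_eq_square)
  then have "q + c * (u + v) = 0" "q + c * (u + w) = 0" using assms(4,6) by simp_all
  then have "c * (v - w) = 0" by algebra
  then show ?thesis using assms(5) by simp
qed

section \<open>The objective along a ray\<close>

locale dual_data =
  fixes n :: nat and x :: "nat \<Rightarrow> real" and \<tau> \<mu> \<sigma> \<delta> :: real
  assumes n_pos: "n \<ge> 1"
begin

abbreviation F :: "real \<Rightarrow> real \<Rightarrow> real \<Rightarrow> ereal" where
  "F \<equiv> dual_obj n x \<tau> \<mu> \<sigma> \<delta>"

text \<open>
  The growth rate of the objective along the ray as \<open>r \<rightarrow> \<infinity>\<close>, since the hinge terms stay bounded.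
\<close>

definition slope :: "real \<Rightarrow> real \<Rightarrow> real" where
  "slope \<theta> \<phi> = alpha \<mu> \<sigma> \<delta> \<theta> \<phi> - alpha0 \<theta> \<phi> / real n * (\<Sum>k=1..n. (x k)\<^sup>2)
                 + 1 / real n * (\<Sum>k=1..n. beta x \<theta> \<phi> k)"

abbreviation height :: "real \<Rightarrow> real \<Rightarrow> nat \<Rightarrow> real" where
  "height \<theta> \<phi> k \<equiv> b_tilde x \<theta> \<phi> k / a_tilde \<theta> \<phi> - \<tau>"

abbreviation G :: "real \<Rightarrow> real \<Rightarrow> real \<Rightarrow> real" where
  "G \<theta> \<phi> \<equiv> hinge_ray.f (slope \<theta> \<phi>) (1 / real n) (1 / (4 * a_tilde \<theta> \<phi>)) {1..n} (height \<theta> \<phi>)"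

abbreviation G_minimizer :: "real \<Rightarrow> real \<Rightarrow> real \<Rightarrow> bool" where
  "G_minimizer \<theta> \<phi> \<equiv>
     hinge_ray.minimizer (slope \<theta> \<phi>) (1 / real n) (1 / (4 * a_tilde \<theta> \<phi>)) {1..n} (height \<theta> \<phi>)"

lemma hinge_ray_direction:
  "0 < a_tilde \<theta> \<phi> \<Longrightarrow> hinge_ray (1 / real n) (1 / (4 * a_tilde \<theta> \<phi>)) {1..n}"
  using n_pos by unfold_locales auto

lemma G_eq:
  assumes "0 < a_tilde \<theta> \<phi>"
  shows "G \<theta> \<phi> r = slope \<theta> \<phi> * r + 1 / real n *
    (\<Sum>k=1..n. max 0 (b_tilde x \<theta> \<phi> k / a_tilde \<theta> \<phi> - \<tau> + 1 / (4 * a_tilde \<theta> \<phi>) / r))"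
  by (rule hinge_ray.f_def[OF hinge_ray_direction[OF assms]])

text \<open>
  On the ray the coefficients of the inner problem are \<open>r\<close> times those of the direction.  The term
  \<open>b\<^sup>2 / a\<close> of the supremum scales like \<open>r\<close> and joins the linear part, \<open>b / a\<close> does not change, and
  \<open>1 / (4 a)\<close> scales like \<open>1 / r\<close>.
\<close>

lemma dual_obj_eq_G:
  assumes r: "0 < r" and a: "0 < a_tilde \<theta> \<phi>"
  shows "F r \<theta> \<phi> = ereal (G \<theta> \<phi> r)"
proof -
  let ?A = "r * sin \<theta> * cos \<phi>" and ?B = "r * cos \<theta>" and ?C = "r * sin \<theta> * sin \<phi>"
  have AC: "?A + ?C = r * a_tilde \<theta> \<phi>" by (simp add: a_tilde_def algebra_simps)
  have AB: "?A * x k - ?B / 2 = r * b_tilde x \<theta> \<phi> k" for k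
    by (simp add: b_tilde_def algebra_simps)
  have sup: "(SUP y. ereal (max (y - \<tau>) 0 - ?A * (y - x k)\<^sup>2 - ?B * y - ?C * y\<^sup>2))
      = ereal (r * beta x \<theta> \<phi> k - r * alpha0 \<theta> \<phi> * (x k)\<^sup>2
          + max 0 (b_tilde x \<theta> \<phi> k / a_tilde \<theta> \<phi> - \<tau> + 1 / (4 * a_tilde \<theta> \<phi>) / r))" for k
  proof -
    have "?A + ?C > 0" using r a AC by simp
    then have "(SUP y. ereal (max (y - \<tau>) 0 - ?A * (y - x k)\<^sup>2 - ?B * y - ?C * y\<^sup>2))
      = ereal ((r * b_tilde x \<theta> \<phi> k)\<^sup>2 / (r * a_tilde \<theta> \<phi>) - ?A * (x k)\<^sup>2
          + max 0 ((r * b_tilde x \<theta> \<phi> k) / (r * a_tilde \<theta> \<phi>) - \<tau> + 1 / (4 * (r * a_tilde \<theta> \<phi>))))"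
      unfolding AB[symmetric] AC[symmetric] by (rule SUP_hinge_quadratic)
    also have "(r * b_tilde x \<theta> \<phi> k)\<^sup>2 / (r * a_tilde \<theta> \<phi>) = r * beta x \<theta> \<phi> k"
      using r by (simp add: beta_def power2_eq_square)
    also have "(r * b_tilde x \<theta> \<phi> k) / (r * a_tilde \<theta> \<phi>) = b_tilde x \<theta> \<phi> k / a_tilde \<theta> \<phi>"
      using r by simp
    also have "1 / (4 * (r * a_tilde \<theta> \<phi>)) = 1 / (4 * a_tilde \<theta> \<phi>) / r" by simp
    also have "?A * (x k)\<^sup>2 = r * alpha0 \<theta> \<phi> * (x k)\<^sup>2" by (simp add: alpha0_def)
    finally show ?thesis .
  qed
  have linear: "?A * \<delta> + ?B * \<mu> + ?C * (\<sigma>\<^sup>2 + \<mu>\<^sup>2) = r * alpha \<mu> \<sigma> \<delta> \<theta> \<phi>"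
    by (simp add: alpha_def alpha0_def algebra_simps)
  show ?thesis
    unfolding dual_obj_def sup linear sum_ereal times_ereal.simps plus_ereal.simps G_eq[OF a]
    by (simp add: slope_def sum.distrib sum_subtractf sum_distrib_left[symmetric] algebra_simps)
qed

lemma dual_obj_infinite:
  assumes "0 \<le> r" "\<not> (0 < r \<and> 0 < a_tilde \<theta> \<phi>)"
  shows "F r \<theta> \<phi> = \<infinity>"
proof -
  have "r * sin \<theta> * cos \<phi> + r * sin \<theta> * sin \<phi> = r * a_tilde \<theta> \<phi>"
    by (simp add: a_tilde_def algebra_simps)
  also have "\<dots> \<le> 0" using assms by (cases "r = 0") (auto simp: mult_nonneg_nonpos)
  finally have "(\<Sum>k=1..n. SUP y. ereal (max (y - \<tau>) 0 - r * sin \<theta> * cos \<phi> * (y - x k)\<^sup>2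
      - r * cos \<theta> * y - r * sin \<theta> * sin \<phi> * y\<^sup>2)) = \<infinity>"
    using n_pos by (auto simp: SUP_hinge_quadratic_infinite sum_Pinfty intro: exI[of _ 1])
  then show ?thesis unfolding dual_obj_def using n_pos by simp
qed

text \<open>
  The subdifferential is taken on all of \<open>[0, \<infinity>)\<close>, so a critical point is a finite minimum over the
  whole half-line; the end point \<open>0\<close> drops out because \<open>F\<close> is infinite there.
\<close>

lemma critical_iff_minimizer:
  assumes a: "0 < a_tilde \<theta> \<phi>"
  shows "critical F \<theta> \<phi> r \<longleftrightarrow> G_minimizer \<theta> \<phi> r"
proof -
  interpret hinge_ray "slope \<theta> \<phi>" "1 / real n" "1 / (4 * a_tilde \<theta> \<phi>)" "{1..n}" "height \<theta> \<phi>"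
    by (rule hinge_ray_direction[OF a])
  have "critical F \<theta> \<phi> r \<longleftrightarrow> 0 \<le> r \<and> \<bar>F r \<theta> \<phi>\<bar> \<noteq> \<infinity> \<and> (\<forall>q\<ge>0. F r \<theta> \<phi> \<le> F q \<theta> \<phi>)"
    by (simp add: critical_def subdifferential_def flip: zero_ereal_def)
  also have "\<dots> \<longleftrightarrow> 0 < r \<and> (\<forall>q\<ge>0. F r \<theta> \<phi> \<le> F q \<theta> \<phi>)"
    using dual_obj_infinite[of 0 \<theta> \<phi>] dual_obj_eq_G[OF _ a] by (cases "r = 0") auto
  also have "\<dots> \<longleftrightarrow> 0 < r \<and> (\<forall>q>0. F r \<theta> \<phi> \<le> F q \<theta> \<phi>)"
    using dual_obj_infinite[of 0 \<theta> \<phi>] by (metis ereal_less_eq(1) less_irrefl order_le_less)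
  also have "\<dots> \<longleftrightarrow> minimizer r"
    unfolding minimizer_def using dual_obj_eq_G[OF _ a] by auto
  finally show ?thesis .
qed

lemma direction_analysis:
  assumes a: "0 < a_tilde \<theta> \<phi>"
  shows "0 < slope \<theta> \<phi> \<Longrightarrow> \<exists>!r. critical F \<theta> \<phi> r"
    and "critical F \<theta> \<phi> r \<Longrightarrow> 0 < r"
    and "slope \<theta> \<phi> < 0 \<Longrightarrow> \<exists>r>0. F r \<theta> \<phi> \<le> ereal B"
    and "0 \<le> slope \<theta> \<phi> \<Longrightarrow> 0 < r \<Longrightarrow> 0 \<le> F r \<theta> \<phi>"
proof -
  interpret hinge_ray "slope \<theta> \<phi>" "1 / real n" "1 / (4 * a_tilde \<theta> \<phi>)" "{1..n}" "height \<theta> \<phi>"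
    by (rule hinge_ray_direction[OF a])
  note critical = critical_iff_minimizer[OF a]
  show "\<exists>!r. critical F \<theta> \<phi> r" if "0 < slope \<theta> \<phi>"
  proof -
    have "{1..n} \<noteq> {}" using n_pos by simp
    then show ?thesis
      unfolding critical using minimizer_exists[OF that] minimizer_unique[OF that] by blast
  qed
  show "0 < r" if "critical F \<theta> \<phi> r" using that unfolding critical minimizer_def by simp
  show "\<exists>r>0. F r \<theta> \<phi> \<le> ereal B" if "slope \<theta> \<phi> < 0"
    using f_unbounded_below[OF that, of B] dual_obj_eq_G[OF _ a] by auto
  show "0 \<le> F r \<theta> \<phi>" if "0 \<le> slope \<theta> \<phi>" "0 < r"
    using f_nonneg[OF that] dual_obj_eq_G[OF that(2) a] by simp
qed

text \<open>
  The sets \<open>K1\<close> and \<open>K2\<close> collect the weakly and the strictly active hinges of the ray.  Since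
  \<open>real_of_ereal\<close> sends \<open>\<infinity>\<close> to \<open>0\<close>, it agrees with \<open>G\<close> only where \<open>F\<close> is finite; this includes a
  neighbourhood of every \<open>r > 0\<close>.
\<close>

lemma one_sided_derivatives:
  assumes a: "0 < a_tilde \<theta> \<phi>" and r: "0 < r"
  defines "D \<equiv> \<lambda>K. alpha \<mu> \<sigma> \<delta> \<theta> \<phi> - alpha0 \<theta> \<phi> / real n * (\<Sum>k=1..n. (x k)\<^sup>2)
                   + 1 / real n * ((\<Sum>k=1..n. beta x \<theta> \<phi> k)
                       - (\<Sum>k\<in>K. 1 / (4 * r\<^sup>2 * a_tilde \<theta> \<phi>)))"
  shows "\<bar>F r \<theta> \<phi>\<bar> \<noteq> \<infinity>"
    and "((\<lambda>q. real_of_ereal (F q \<theta> \<phi>)) has_real_derivative D (K1 n x \<tau> \<theta> \<phi> r)) (at_left r)"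
    and "((\<lambda>q. real_of_ereal (F q \<theta> \<phi>)) has_real_derivative D (K2 n x \<tau> \<theta> \<phi> r)) (at_right r)"
    and "critical F \<theta> \<phi> r \<longleftrightarrow> D (K1 n x \<tau> \<theta> \<phi> r) \<le> 0 \<and> 0 \<le> D (K2 n x \<tau> \<theta> \<phi> r)"
proof -
  interpret hinge_ray "slope \<theta> \<phi>" "1 / real n" "1 / (4 * a_tilde \<theta> \<phi>)" "{1..n}" "height \<theta> \<phi>"
    by (rule hinge_ray_direction[OF a])
  have D: "D K = slope_on K r" for K
  proof -
    have "1 / (4 * r\<^sup>2 * a_tilde \<theta> \<phi>) = 1 / (4 * a_tilde \<theta> \<phi>) / r\<^sup>2" by simp
    then show ?thesis
      unfolding D_def slope_on_def by (simp only: slope_def right_diff_distrib add_diff_eq)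
  qed
  have threshold: "b_tilde x \<theta> \<phi> k / a_tilde \<theta> \<phi> + 1 / (4 * r * a_tilde \<theta> \<phi>) - \<tau>
      = height \<theta> \<phi> k + 1 / (4 * a_tilde \<theta> \<phi>) / r" for k
  proof -
    have "1 / (4 * r * a_tilde \<theta> \<phi>) = 1 / (4 * a_tilde \<theta> \<phi>) / r" by simp
    then show ?thesis by (simp only: diff_add_eq)
  qed
  have K1: "K1 n x \<tau> \<theta> \<phi> r = weakly_active r" unfolding K1_def threshold by (rule refl)
  have K2: "K2 n x \<tau> \<theta> \<phi> r = strictly_active r" unfolding K2_def threshold by (rule refl)
  have eq: "\<forall>\<^sub>F q in at r within S. real_of_ereal (F q \<theta> \<phi>) = G \<theta> \<phi> q" for S
  proof -
    have "\<forall>\<^sub>F q in at r within S. 0 < q"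
      using order_tendstoD(1)[OF tendsto_ident_at r] .
    then show ?thesis by eventually_elim (simp add: dual_obj_eq_G a)
  qed
  have eq_r: "real_of_ereal (F r \<theta> \<phi>) = G \<theta> \<phi> r" by (simp add: dual_obj_eq_G a r)
  show "\<bar>F r \<theta> \<phi>\<bar> \<noteq> \<infinity>" by (simp add: dual_obj_eq_G a r)
  show "((\<lambda>q. real_of_ereal (F q \<theta> \<phi>)) has_real_derivative D (K1 n x \<tau> \<theta> \<phi> r)) (at_left r)"
    unfolding D K1
    by (rule iffD2[OF has_field_derivative_cong_eventually[OF eq eq_r] left_derivative[OF r]])
  show "((\<lambda>q. real_of_ereal (F q \<theta> \<phi>)) has_real_derivative D (K2 n x \<tau> \<theta> \<phi> r)) (at_right r)"
    unfolding D K2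
    by (rule iffD2[OF has_field_derivative_cong_eventually[OF eq eq_r] right_derivative[OF r]])
  show "critical F \<theta> \<phi> r \<longleftrightarrow> D (K1 n x \<tau> \<theta> \<phi> r) \<le> 0 \<and> 0 \<le> D (K2 n x \<tau> \<theta> \<phi> r)"
    unfolding D K1 K2 critical_iff_minimizer[OF a] by (rule minimizer_iff_slopes[OF r])
qed

section \<open>The dual value\<close>

lemma dual_value_le:
  assumes "(\<theta>, \<phi>) \<in> angle_box" "admissible \<theta> \<phi>" "0 \<le> r"
  shows "dual_value F \<le> F r \<theta> \<phi>"
proof -
  have "(r, \<theta>, \<phi>) \<in> dual_feasible"
    using assms by (simp add: dual_feasible_def admissible_def mult.assoc)
  then show ?thesis unfolding dual_value_def by (rule INF_lower2) simp
qed

text \<open>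
  A feasible point with a finite value has \<open>r > 0\<close> and \<open>a_tilde \<theta> \<phi> > 0\<close>.  Dividing the constraint
  \<open>r sin \<theta> cos \<phi> \<ge> 0\<close> by \<open>r\<close> shows that its direction is admissible, so restricting the search to
  admissible directions loses nothing.
\<close>

lemma dual_value_less:
  assumes "dual_value F < y"
  obtains r \<theta> \<phi> where "(\<theta>, \<phi>) \<in> angle_box" "admissible \<theta> \<phi>" "0 < r" "F r \<theta> \<phi> < y"
proof -
  obtain r \<theta> \<phi> where p: "(r, \<theta>, \<phi>) \<in> dual_feasible" "F r \<theta> \<phi> < y"
    using assms unfolding dual_value_def INF_less_iff by auto
  then have "F r \<theta> \<phi> \<noteq> \<infinity>" by auto
  moreover have "0 \<le> r" using p(1) by (simp add: dual_feasible_def)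
  ultimately have pos: "0 < r" "0 < a_tilde \<theta> \<phi>"
    using dual_obj_infinite[OF \<open>0 \<le> r\<close>, of \<theta> \<phi>] by blast+
  have "0 \<le> r * (sin \<theta> * cos \<phi>)" using p(1) by (simp add: dual_feasible_def mult.assoc)
  then have "admissible \<theta> \<phi>"
    using pos by (simp add: admissible_def a_tilde_def zero_le_mult_iff)
  then show thesis using p pos that[of \<theta> \<phi> r] by (auto simp: dual_feasible_def)
qed

lemma dual_value_less_infinity: "dual_value F < \<infinity>"
proof -
  have "(pi / 2, 0) \<in> angle_box" "admissible (pi / 2) 0"
    using pi_gt_zero by (simp_all add: angle_box_def admissible_def)
  then have "dual_value F \<le> F 1 (pi / 2) 0" by (intro dual_value_le) auto
  also have "\<dots> = ereal (G (pi / 2) 0 1)" by (intro dual_obj_eq_G) (auto simp: a_tilde_def)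
  also have "\<dots> < \<infinity>" by simp
  finally show ?thesis .
qed

lemma slope_nonneg_if_dual_value_finite:
  assumes "dual_value F \<noteq> -\<infinity>" "(\<theta>, \<phi>) \<in> angle_box" "admissible \<theta> \<phi>"
  shows "0 \<le> slope \<theta> \<phi>"
proof (rule ccontr)
  assume "\<not> ?thesis"
  then have "\<exists>r>0. F r \<theta> \<phi> \<le> ereal B" for B
    by (intro direction_analysis(3) admissible_a_tilde assms) simp
  then have "dual_value F \<le> ereal B" for B
    using dual_value_le[OF assms(2,3)] by (meson less_imp_le order_trans)
  then show False using assms(1) ereal_bot by blast
qed

text \<open>
  A negative value is enough, because \<open>F\<close> is nonnegative along rays of nonnegative slope.
\<close>

lemma negative_slope_if_dual_value_infinite:
  assumes "dual_value F = -\<infinity>"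
  obtains \<theta> \<phi> where "(\<theta>, \<phi>) \<in> angle_box" "admissible \<theta> \<phi>" "slope \<theta> \<phi> < 0"
proof -
  have "dual_value F < 0" using assms by simp
  then obtain r \<theta> \<phi> where p: "(\<theta>, \<phi>) \<in> angle_box" "admissible \<theta> \<phi>" "0 < r" "F r \<theta> \<phi> < 0"
    by (rule dual_value_less)
  then have "slope \<theta> \<phi> < 0"
    using direction_analysis(4)[OF admissible_a_tilde[OF p(2)] _ p(3)] by (meson not_le)
  then show thesis using that p by blast
qed

section \<open>Moving to an open set of good directions\<close>

lemma slope_tendsto:
  assumes "0 < a_tilde \<theta> \<phi>"
  shows "((\<lambda>q. slope (fst q) (snd q)) \<longlongrightarrow> slope \<theta> \<phi>) (nhds (\<theta>, \<phi>))"
proof -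
  have "isCont (\<lambda>q. slope (fst q) (snd q)) (\<theta>, \<phi>)"
    using assms n_pos
    unfolding slope_def alpha_def alpha0_def beta_def b_tilde_def a_tilde_def
    by (intro continuous_intros) auto
  then show ?thesis by (simp add: isCont_def tendsto_nhds_iff)
qed

lemma eventually_G_less:
  assumes a: "0 < a_tilde \<theta> \<phi>" and "0 < r" "G \<theta> \<phi> r < B"
  shows "\<forall>\<^sub>F q in nhds (\<theta>, \<phi>). G (fst q) (snd q) r < B"
proof -
  let ?H = "\<lambda>q. 1 / real n * (\<Sum>k=1..n. max 0 (b_tilde x (fst q) (snd q) k / a_tilde (fst q) (snd q)
    - \<tau> + 1 / (4 * a_tilde (fst q) (snd q)) / r))"
  have "isCont ?H (\<theta>, \<phi>)"
    using assms n_pos unfolding b_tilde_def a_tilde_def by (intro continuous_intros) auto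
  then have "(?H \<longlongrightarrow> ?H (\<theta>, \<phi>)) (nhds (\<theta>, \<phi>))"
    by (simp add: isCont_def tendsto_nhds_iff)
  then have "((\<lambda>q. slope (fst q) (snd q) * r + ?H q) \<longlongrightarrow> slope \<theta> \<phi> * r + ?H (\<theta>, \<phi>)) (nhds (\<theta>, \<phi>))"
    by (intro tendsto_add[OF tendsto_mult[OF slope_tendsto[OF a] tendsto_const]])
  then have "\<forall>\<^sub>F q in nhds (\<theta>, \<phi>). slope (fst q) (snd q) * r + ?H q < B"
    by (rule order_tendstoD(2)) (use assms(3) in \<open>simp only: G_eq[OF a] fst_conv snd_conv\<close>)
  with eventually_a_tilde_pos[OF a] show ?thesis
    by eventually_elim (simp only: G_eq)
qed

text \<open>
  The slope is homogeneous of degree one in \<open>(\<lambda>\<^sub>1, \<lambda>\<^sub>2, \<lambda>\<^sub>3)\<close>, so dividing by \<open>sin \<theta>\<close> leaves a function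
  of \<open>\<lambda>\<^sub>2 / sin \<theta> = cot \<theta>\<close> and \<open>\<phi>\<close>.  The square of the cotangent enters only through the mean of
  \<open>b_tilde\<^sup>2 / a_tilde\<close>, where its coefficient is positive for every sample.
\<close>

lemma slope_eq_quadratic_in_cot:
  assumes "0 < sin \<theta>" "0 < cos \<phi> + sin \<phi>"
  defines "w \<equiv> cos \<phi> + sin \<phi>"
    and "M1 \<equiv> (\<Sum>k=1..n. x k) / n" and "M2 \<equiv> (\<Sum>k=1..n. (x k)\<^sup>2) / n"
  shows "slope \<theta> \<phi> = sin \<theta> *
    ((cos \<phi> * (\<delta> - M2) + sin \<phi> * (\<sigma>\<^sup>2 + \<mu>\<^sup>2) + (cos \<phi>)\<^sup>2 * M2 / w)
      + (\<mu> - cos \<phi> * M1 / w) * (cos \<theta> / sin \<theta>) + 1 / (4 * w) * (cos \<theta> / sin \<theta>)\<^sup>2)"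
proof -
  define t where "t = cos \<theta> / sin \<theta>"
  have n: "real n \<noteq> 0" using n_pos by simp
  have cos: "cos \<theta> = sin \<theta> * t" using assms(1) by (simp add: t_def)
  have beta: "beta x \<theta> \<phi> k = sin \<theta> * ((cos \<phi> * x k - t / 2)\<^sup>2 / w)" for k
    using assms(1,2) unfolding beta_def b_tilde_def a_tilde_def cos w_def[symmetric]
    by (simp add: field_simps power2_eq_square)
  have square: "(cos \<phi> * x k - t / 2)\<^sup>2 / w
      = ((cos \<phi>)\<^sup>2 / w) * (x k)\<^sup>2 - (cos \<phi> * t / w) * x k + t\<^sup>2 / (4 * w)" for k
    using assms(2) by (simp add: w_def[symmetric] field_simps power2_eq_square)
  have "(\<Sum>k=1..n. beta x \<theta> \<phi> k)
      = sin \<theta> * (((cos \<phi>)\<^sup>2 / w) * (\<Sum>k=1..n. (x k)\<^sup>2) - (cos \<phi> * t / w) * (\<Sum>k=1..n. x k) + n * (t\<^sup>2 / (4 * w)))"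
    unfolding beta square sum_distrib_left[symmetric] sum.distrib sum_subtractf by simp
  also have "\<dots> = n * (sin \<theta> * (((cos \<phi>)\<^sup>2 / w) * M2 - (cos \<phi> * t / w) * M1 + t\<^sup>2 / (4 * w)))"
    using n by (simp add: M1_def M2_def algebra_simps)
  finally have mean: "1 / n * (\<Sum>k=1..n. beta x \<theta> \<phi> k)
      = sin \<theta> * (((cos \<phi>)\<^sup>2 / w) * M2 - (cos \<phi> * t / w) * M1 + t\<^sup>2 / (4 * w))"
    using n by simp
  have "alpha0 \<theta> \<phi> / n * (\<Sum>k=1..n. (x k)\<^sup>2) = sin \<theta> * cos \<phi> * M2"
    by (simp add: alpha0_def M2_def)
  then show ?thesis
    unfolding slope_def mean t_def[symmetric] alpha_def alpha0_def cos by (simp add: algebra_simps)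
qed

text \<open>
  If the slope vanished at three angles close to \<open>\<theta>\<close>, a quadratic in the cotangent with nonzero
  leading coefficient would have three roots.
\<close>

lemma eventually_nonzero_slope_near:
  assumes box: "(\<theta>, \<phi>) \<in> angle_box" and adm: "admissible \<theta> \<phi>"
    and P: "\<forall>\<^sub>F q in nhds (\<theta>, \<phi>). P q"
  obtains t where "(t, \<phi>) \<in> angle_box" "slope t \<phi> \<noteq> 0" "\<forall>\<^sub>F q in nhds (t, \<phi>). P q"
proof -
  have sin: "0 < sin \<theta>" by (rule sin_pos_if_admissible[OF box adm])
  have w: "0 < cos \<phi> + sin \<phi>" using adm sin by (simp add: admissible_def zero_less_mult_iff)
  have "\<theta> \<noteq> 0" "\<theta> \<noteq> pi" using sin by auto
  then have \<theta>: "0 < \<theta>" "\<theta> < pi" using box by (auto simp: angle_box_def)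
  obtain d where d: "0 < d" "\<And>s t. \<bar>\<theta> - s\<bar> < d \<Longrightarrow> \<bar>\<phi> - t\<bar> < d \<Longrightarrow> \<forall>\<^sub>F q in nhds (s, t). P q"
    using eventually_nhds_prod_real[of "\<lambda>q. eventually P (nhds q)" \<theta> \<phi>] P
    by (simp only: eventually_eventually) blast
  define e where "e = min d (pi - \<theta>)"
  have e: "0 < e" "e \<le> d" "\<theta> + e \<le> pi" using d(1) \<theta> by (auto simp: e_def)
  have "\<exists>t \<in> {\<theta>, \<theta> + e / 3, \<theta> + e / 2}. slope t \<phi> \<noteq> 0"
  proof (rule ccontr)
    assume none: "\<not> ?thesis"
    define cot where "cot = (\<lambda>t::real. cos t / sin t)"
    obtain p q where pq: "\<And>t. 0 < sin t \<Longrightarrow>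
        slope t \<phi> = sin t * (p + q * cot t + 1 / (4 * (cos \<phi> + sin \<phi>)) * (cot t)\<^sup>2)"
      using slope_eq_quadratic_in_cot[OF _ w] unfolding cot_def by blast
    have root: "p + q * cot t + 1 / (4 * (cos \<phi> + sin \<phi>)) * (cot t)\<^sup>2 = 0"
      if "t \<in> {\<theta>, \<theta> + e / 3, \<theta> + e / 2}" for t
    proof -
      have "0 < sin t" using that \<theta> e by (intro sin_gt_zero) auto
      moreover have "slope t \<phi> = 0" using none that by blast
      ultimately show ?thesis using pq[of t] by simp
    qed
    have inj: "cot s \<noteq> cot t" if "s \<noteq> t" "s \<in> {0<..<pi}" "t \<in> {0<..<pi}" for s t
      using inj_on_cot_0_pi that unfolding cot_def inj_on_def by blast
    have "1 / (4 * (cos \<phi> + sin \<phi>)) = 0"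
      by (rule quadratic_three_roots[of p q "cot \<theta>" _ "cot (\<theta> + e / 3)" "cot (\<theta> + e / 2)"])
        (rule root inj; use \<theta> e in simp)+
    then show False using w by simp
  qed
  then obtain t where t: "t \<in> {\<theta>, \<theta> + e / 3, \<theta> + e / 2}" "slope t \<phi> \<noteq> 0" by blast
  show thesis
  proof (rule that[OF _ t(2)])
    show "(t, \<phi>) \<in> angle_box" using t(1) \<theta> e box by (auto simp: angle_box_def)
    show "\<forall>\<^sub>F q in nhds (t, \<phi>). P q" using t(1) d(1) e by (intro d(2)) auto
  qed
qed

text \<open>
  A single \<open>r\<close> serves all grid points: it belongs to a nearly optimal feasible point, and for this
  fixed \<open>r\<close> the objective stays nearly optimal in a neighbourhood of the direction.  The perturbation
  to a nonzero slope comes last and inside that neighbourhood; finiteness of the dual value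
  then turns nonzero into positive.
\<close>

lemma grid_hits_near_optimal_direction:
  assumes finite: "dual_value F \<noteq> -\<infinity>" and "0 < \<epsilon>"
  obtains h r where "0 < h" "0 < r"
    "\<And>\<theta>s \<phi>s. angle_grid h \<theta>s \<phi>s \<Longrightarrow> \<exists>\<theta>\<in>set \<theta>s. \<exists>\<phi>\<in>set \<phi>s.
        admissible \<theta> \<phi> \<and> 0 < slope \<theta> \<phi> \<and> F r \<theta> \<phi> < dual_value F + ereal \<epsilon>"
proof -
  obtain v where v: "dual_value F = ereal v"
    using finite dual_value_less_infinity by (cases "dual_value F") auto
  then have "dual_value F < ereal (v + \<epsilon>)" using assms(2) by simp
  then obtain r \<theta>0 \<phi>0 where p0: "(\<theta>0, \<phi>0) \<in> angle_box" "admissible \<theta>0 \<phi>0" "0 < r"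
      "F r \<theta>0 \<phi>0 < ereal (v + \<epsilon>)"
    by (rule dual_value_less)
  have "\<forall>\<^sub>F q in nhds (\<theta>0, \<phi>0). F r (fst q) (snd q) < ereal (v + \<epsilon>)"
  proof -
    have a: "0 < a_tilde \<theta>0 \<phi>0" by (rule admissible_a_tilde[OF p0(2)])
    then have "G \<theta>0 \<phi>0 r < v + \<epsilon>" using p0 by (simp add: dual_obj_eq_G)
    from eventually_G_less[OF a p0(3) this] eventually_a_tilde_pos[OF a]
    show ?thesis by eventually_elim (auto simp: dual_obj_eq_G p0(3))
  qed
  then obtain \<phi>1 where p1: "(\<theta>0, \<phi>1) \<in> angle_box" "admissible \<theta>0 \<phi>1"
    "\<forall>\<^sub>F q in nhds (\<theta>0, \<phi>1). F r (fst q) (snd q) < ereal (v + \<epsilon>) \<and> admissible (fst q) (snd q)"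
    by (rule eventually_admissible_near[OF p0(1,2)])
  obtain \<theta>2 where p2: "(\<theta>2, \<phi>1) \<in> angle_box" "slope \<theta>2 \<phi>1 \<noteq> 0"
    "\<forall>\<^sub>F q in nhds (\<theta>2, \<phi>1). F r (fst q) (snd q) < ereal (v + \<epsilon>) \<and> admissible (fst q) (snd q)"
    by (rule eventually_nonzero_slope_near[OF p1])
  have adm: "admissible \<theta>2 \<phi>1" using eventually_nhds_x_imp_x[OF p2(3)] by simp
  have "0 < slope \<theta>2 \<phi>1"
    using slope_nonneg_if_dual_value_finite[OF finite p2(1) adm] p2(2) by simp
  then have "\<forall>\<^sub>F q in nhds (\<theta>2, \<phi>1). 0 < slope (fst q) (snd q)"
    by (intro order_tendstoD(1)[OF slope_tendsto[OF admissible_a_tilde[OF adm]]])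
  with p2(3) have "\<forall>\<^sub>F q in nhds (\<theta>2, \<phi>1). admissible (fst q) (snd q) \<and> 0 < slope (fst q) (snd q)
      \<and> F r (fst q) (snd q) < dual_value F + ereal \<epsilon>"
    by eventually_elim (simp add: v)
  from angle_grid_meets_neighbourhood[OF p2(1) this]
  obtain h where "0 < h" "\<And>\<theta>s \<phi>s. angle_grid h \<theta>s \<phi>s \<Longrightarrow> \<exists>\<theta>\<in>set \<theta>s. \<exists>\<phi>\<in>set \<phi>s.
        admissible \<theta> \<phi> \<and> 0 < slope \<theta> \<phi> \<and> F r \<theta> \<phi> < dual_value F + ereal \<epsilon>"
    by (metis fst_conv snd_conv)
  then show thesis using that p0(3) by blast
qed

lemma grid_detects_unboundedness:
  assumes "dual_value F = -\<infinity>"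
  shows "\<exists>h>0. \<forall>\<theta>s \<phi>s. angle_grid h \<theta>s \<phi>s \<longrightarrow>
    (\<exists>\<theta>\<in>set \<theta>s. \<exists>\<phi>\<in>set \<phi>s. admissible \<theta> \<phi> \<and> (INF r\<in>{0..}. F r \<theta> \<phi>) = -\<infinity>)"
proof -
  obtain \<theta>0 \<phi>0 where p0: "(\<theta>0, \<phi>0) \<in> angle_box" "admissible \<theta>0 \<phi>0" "slope \<theta>0 \<phi>0 < 0"
    using negative_slope_if_dual_value_infinite[OF assms] .
  have "\<forall>\<^sub>F q in nhds (\<theta>0, \<phi>0). slope (fst q) (snd q) < 0"
    by (rule order_tendstoD(2)[OF slope_tendsto[OF admissible_a_tilde[OF p0(2)]] p0(3)])
  then obtain \<phi>1 where p1: "(\<theta>0, \<phi>1) \<in> angle_box" "admissible \<theta>0 \<phi>1"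
    "\<forall>\<^sub>F q in nhds (\<theta>0, \<phi>1). slope (fst q) (snd q) < 0 \<and> admissible (fst q) (snd q)"
    by (rule eventually_admissible_near[OF p0(1,2)])
  obtain h where h: "0 < h" "\<And>\<theta>s \<phi>s. angle_grid h \<theta>s \<phi>s \<Longrightarrow>
      \<exists>\<theta>\<in>set \<theta>s. \<exists>\<phi>\<in>set \<phi>s. slope \<theta> \<phi> < 0 \<and> admissible \<theta> \<phi>"
    using angle_grid_meets_neighbourhood[OF p1(1,3)] by (metis fst_conv snd_conv)
  have "(INF r\<in>{0..}. F r \<theta> \<phi>) = -\<infinity>" if "slope \<theta> \<phi> < 0" "admissible \<theta> \<phi>" for \<theta> \<phi>
  proof -
    have "(INF r\<in>{0..}. F r \<theta> \<phi>) \<le> ereal B" for B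
      using direction_analysis(3)[OF admissible_a_tilde[OF that(2)] that(1), of B]
      by (meson INF_lower2 atLeast_iff less_imp_le)
    then show ?thesis using ereal_bot by blast
  qed
  then show ?thesis using h by blast
qed

section \<open>The search list\<close>

lemma set_search_list:
  "set (search_list f \<theta>s \<phi>s rs) = {(\<theta>, \<phi>, rs \<theta> \<phi>) | \<theta> \<phi>.
     \<theta> \<in> set \<theta>s \<and> \<phi> \<in> set \<phi>s \<and> admissible \<theta> \<phi> \<and> critical f \<theta> \<phi> (rs \<theta> \<phi>)}"
  by (auto simp: search_list_def)

lemma dual_value_le_list_min:
  assumes "angle_grid h \<theta>s \<phi>s" "search_list F \<theta>s \<phi>s rs \<noteq> []"
  shows "dual_value F \<le> list_min F (search_list F \<theta>s \<phi>s rs)"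
proof -
  have "dual_value F \<le> F (rs \<theta> \<phi>) \<theta> \<phi>"
    if "\<theta> \<in> set \<theta>s" "\<phi> \<in> set \<phi>s" "admissible \<theta> \<phi>" "critical F \<theta> \<phi> (rs \<theta> \<phi>)" for \<theta> \<phi>
  proof (rule dual_value_le)
    show "(\<theta>, \<phi>) \<in> angle_box" using assms(1) that unfolding angle_grid_def by blast
    show "0 \<le> rs \<theta> \<phi>" using that(4) by (simp add: critical_def subdifferential_def)
  qed fact
  then have "dual_value F \<le> F r \<theta> \<phi>" if "(\<theta>, \<phi>, r) \<in> set (search_list F \<theta>s \<phi>s rs)" for \<theta> \<phi> r
    using that by (auto simp: set_search_list)
  then show ?thesis
    unfolding list_min_def using assms(2) by (intro Min.boundedI) auto
qed

text \<open>
  A positive slope guarantees that the linear search succeeds at this grid point, and the critical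
  point that it returns minimizes over the whole ray.
\<close>

lemma list_min_le:
  assumes "linear_search F \<theta>s \<phi>s rs" "\<theta> \<in> set \<theta>s" "\<phi> \<in> set \<phi>s" "admissible \<theta> \<phi>"
    and "0 < slope \<theta> \<phi>" "0 \<le> r"
  shows "search_list F \<theta>s \<phi>s rs \<noteq> []" "list_min F (search_list F \<theta>s \<phi>s rs) \<le> F r \<theta> \<phi>"
proof -
  have "\<exists>r. critical F \<theta> \<phi> r"
    using direction_analysis(1)[OF admissible_a_tilde[OF assms(4)] assms(5)] by blast
  then have crit: "critical F \<theta> \<phi> (rs \<theta> \<phi>)" using assms unfolding linear_search_def by blast
  then have mem: "(\<theta>, \<phi>, rs \<theta> \<phi>) \<in> set (search_list F \<theta>s \<phi>s rs)"
    using assms by (auto simp: set_search_list)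
  then show "search_list F \<theta>s \<phi>s rs \<noteq> []" by auto
  have "list_min F (search_list F \<theta>s \<phi>s rs) \<le> F (rs \<theta> \<phi>) \<theta> \<phi>"
    unfolding list_min_def using mem by (intro Min_le) (auto intro: rev_image_eqI)
  also have "\<dots> \<le> F r \<theta> \<phi>"
    using crit assms(6) by (simp add: critical_def subdifferential_def flip: zero_ereal_def)
  finally show "list_min F (search_list F \<theta>s \<phi>s rs) \<le> F r \<theta> \<phi>" .
qed

lemma grid_search_converges:
  assumes "dual_value F \<noteq> -\<infinity>" "0 < \<epsilon>"
  shows "\<exists>h>0. \<forall>\<theta>s \<phi>s rs. angle_grid h \<theta>s \<phi>s \<and> linear_search F \<theta>s \<phi>s rs \<longrightarrow>
        search_list F \<theta>s \<phi>s rs \<noteq> [] \<and>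
        dual_value F \<le> list_min F (search_list F \<theta>s \<phi>s rs) \<and>
        list_min F (search_list F \<theta>s \<phi>s rs) \<le> dual_value F + ereal \<epsilon>"
proof -
  obtain h r where h: "0 < h" "0 < r"
    "\<And>\<theta>s \<phi>s. angle_grid h \<theta>s \<phi>s \<Longrightarrow> \<exists>\<theta>\<in>set \<theta>s. \<exists>\<phi>\<in>set \<phi>s.
        admissible \<theta> \<phi> \<and> 0 < slope \<theta> \<phi> \<and> F r \<theta> \<phi> < dual_value F + ereal \<epsilon>"
    using grid_hits_near_optimal_direction[OF assms] by blast
  show ?thesis
  proof (intro exI[of _ h] conjI[OF h(1)] allI impI)
    fix \<theta>s \<phi>s rs assume search: "angle_grid h \<theta>s \<phi>s \<and> linear_search F \<theta>s \<phi>s rs"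
    then obtain \<theta> \<phi> where "\<theta> \<in> set \<theta>s" "\<phi> \<in> set \<phi>s" "admissible \<theta> \<phi>" "0 < slope \<theta> \<phi>"
      and less: "F r \<theta> \<phi> < dual_value F + ereal \<epsilon>"
      using h(3) by blast
    then have ne: "search_list F \<theta>s \<phi>s rs \<noteq> []"
      and "list_min F (search_list F \<theta>s \<phi>s rs) \<le> F r \<theta> \<phi>"
      using list_min_le[of \<theta>s \<phi>s rs \<theta> \<phi> r] search h(2) by auto
    then show "search_list F \<theta>s \<phi>s rs \<noteq> [] \<and>
        dual_value F \<le> list_min F (search_list F \<theta>s \<phi>s rs) \<and>
        list_min F (search_list F \<theta>s \<phi>s rs) \<le> dual_value F + ereal \<epsilon>"
      using dual_value_le_list_min search less by (meson less_imp_le order_trans)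
  qed
qed

end

theorem proposition3p4:
  fixes n :: nat and x :: "nat \<Rightarrow> real" and \<tau> \<mu> \<sigma> \<delta> :: real
  assumes "n \<ge> 1" and "\<sigma> \<ge> 0" and "\<delta> \<ge> 0"
  shows "let F = dual_obj n x \<tau> \<mu> \<sigma> \<delta> in
    (\<forall>\<theta> \<phi>. (\<theta>, \<phi>) \<in> angle_box \<and> 0 < sin \<theta> * (cos \<phi> + sin \<phi>) \<longrightarrow>
      (let slope = alpha \<mu> \<sigma> \<delta> \<theta> \<phi> - alpha0 \<theta> \<phi> / real n * (\<Sum>k=1..n. (x k)\<^sup>2)
                     + 1 / real n * (\<Sum>k=1..n. beta x \<theta> \<phi> k)
       in 0 < slope \<longrightarrow> (\<exists>!r. critical F \<theta> \<phi> r)) \<and>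
      (\<forall>r. critical F \<theta> \<phi> r \<longrightarrow> 0 < r) \<and>
      (\<forall>r>0.
        let Dl = alpha \<mu> \<sigma> \<delta> \<theta> \<phi> - alpha0 \<theta> \<phi> / real n * (\<Sum>k=1..n. (x k)\<^sup>2)
                   + 1 / real n * ((\<Sum>k=1..n. beta x \<theta> \<phi> k)
                       - (\<Sum>k\<in>K1 n x \<tau> \<theta> \<phi> r. 1 / (4 * r\<^sup>2 * a_tilde \<theta> \<phi>)));
            Dr = alpha \<mu> \<sigma> \<delta> \<theta> \<phi> - alpha0 \<theta> \<phi> / real n * (\<Sum>k=1..n. (x k)\<^sup>2)
                   + 1 / real n * ((\<Sum>k=1..n. beta x \<theta> \<phi> k)
                       - (\<Sum>k\<in>K2 n x \<tau> \<theta> \<phi> r. 1 / (4 * r\<^sup>2 * a_tilde \<theta> \<phi>)))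
        in \<bar>F r \<theta> \<phi>\<bar> \<noteq> \<infinity> \<and>
           ((\<lambda>s. real_of_ereal (F s \<theta> \<phi>)) has_real_derivative Dl) (at_left r) \<and>
           ((\<lambda>s. real_of_ereal (F s \<theta> \<phi>)) has_real_derivative Dr) (at_right r) \<and>
           (critical F \<theta> \<phi> r \<longleftrightarrow> Dl \<le> 0 \<and> 0 \<le> Dr))) \<and>
    (dual_value F \<noteq> -\<infinity> \<longrightarrow>
      (\<forall>\<epsilon>>0. \<exists>h>0. \<forall>\<theta>s \<phi>s rs. angle_grid h \<theta>s \<phi>s \<and> linear_search F \<theta>s \<phi>s rs \<longrightarrow>
        search_list F \<theta>s \<phi>s rs \<noteq> [] \<and>
        dual_value F \<le> list_min F (search_list F \<theta>s \<phi>s rs) \<and>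
        list_min F (search_list F \<theta>s \<phi>s rs) \<le> dual_value F + ereal \<epsilon>)) \<and>
    (dual_value F = -\<infinity> \<longrightarrow>
      (\<exists>h>0. \<forall>\<theta>s \<phi>s. angle_grid h \<theta>s \<phi>s \<longrightarrow>
        (\<exists>\<theta>\<in>set \<theta>s. \<exists>\<phi>\<in>set \<phi>s. admissible \<theta> \<phi> \<and> (INF r\<in>{0..}. F r \<theta> \<phi>) = -\<infinity>)))"
proof -
  interpret dual_data n x \<tau> \<mu> \<sigma> \<delta> by unfold_locales fact
  have a: "0 < a_tilde \<theta> \<phi>" if "(\<theta>, \<phi>) \<in> angle_box \<and> 0 < sin \<theta> * (cos \<phi> + sin \<phi>)" for \<theta> \<phi>
    using that by (simp add: a_tilde_def)
  show ?thesis
    unfolding Let_def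
  proof (intro conjI allI impI, goal_cases)
    case (1 \<theta> \<phi>)
    then show ?case using direction_analysis(1)[OF a] unfolding slope_def by blast
  next
    case (2 \<theta> \<phi> r)
    then show ?case using direction_analysis(2)[OF a] by blast
  next
    case (3 \<theta> \<phi> r)
    show ?case by (rule one_sided_derivatives(1)[OF a[OF 3(1)] 3(2)])
  next
    case (4 \<theta> \<phi> r)
    show ?case by (rule one_sided_derivatives(2)[OF a[OF 4(1)] 4(2)])
  next
    case (5 \<theta> \<phi> r)
    show ?case by (rule one_sided_derivatives(3)[OF a[OF 5(1)] 5(2)])
  next
    case (6 \<theta> \<phi> r)
    show ?case by (rule one_sided_derivatives(4)[OF a[OF 6(1)] 6(2)])
  next
    case (7 \<epsilon>)
    then show ?case by (rule grid_search_converges)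
  next
    case 8
    then show ?case by (rule grid_detects_unboundedness)
  qed
qed

end
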